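(* Let $\mathrm{dsv}(n,k)$ denote the sum of the depths of all symmetric valleys over all compositions of $n$ with exactly $k$ parts. (1) For $n\geq 0$ and $k>3$, $$\mathrm{dsv}(n,k)=(k-2)\sum_{m=1}^{\lfloor\frac{n-k+1}{3}\rfloor}\ \sum_{b=m+1}^{\lfloor\frac{n-m-(k-3)}{2}\rfloor}\binom{n-2b-m-1}{k-4}(b-m).$$ (2) For $k=3$ and $n \geq 0$, $$\mathrm{dsv}(n,3)=\sum_{m=1}^{\lfloor\frac{n-2}{3}\rfloor}d_m,$$ where $d_m=\frac{n-3m}{2}$ if $\frac{n-m}{2}$ is an integer, and $d_m=0$ otherwise.
   Context: A composition of $n$ with $k$ parts is a sequence $\pi=\pi_1\pi_2\cdots\pi_k$ of positive integers with $\sum_{i=1}^k\pi_i=n$. A symmetric valley of $\pi$ is a triple of consecutive parts $\pi_i\pi_{i+1}\pi_{i+2}$ ($1\le i\le k-2$) with $\pi_i>\pi_{i+1}$ and $\pi_i=\pi_{i+2}$; its depth is $\pi_i-\pi_{i+1}$. The quantity $\mathrm{dsv}(n,k)$ sums the depths over all pairs (composition $\pi$ of $n$ with exactly $k$ parts, position $i$ of a symmetric valley of $\pi$). Sums whose upper limit is smaller than the lower limit are empty and equal to $0$. *)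

theory Defs
  imports Complex_Main
begin

definition compositions :: "nat \<Rightarrow> nat \<Rightarrow> nat list set" where
  "compositions n k = {p. length p = k \<and> (\<forall>x\<in>set p. 0 < x) \<and> sum_list p = n}"

lemma finite_compositions: "finite (compositions n k)"
proof (rule finite_subset)
  show "compositions n k \<subseteq> {p. set p \<subseteq> {..n} \<and> length p = k}"
    by (auto simp: compositions_def intro: member_le_sum_list)
  show "finite {p. set p \<subseteq> {..n} \<and> length p = k}"
    by (rule finite_lists_length_eq) simp
qed

text \<open>Positions are counted from 0, so the triple at position \<open>i\<close> exists iff \<open>i + 2 < length p\<close>.\<close>

definition symmetric_valley :: "nat list \<Rightarrow> nat \<Rightarrow> bool" where
  "symmetric_valley p i \<longleftrightarrow> i + 2 < length p \<and> p ! i > p ! (i + 1) \<and> p ! i = p ! (i + 2)"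

text \<open>The truncated subtraction is exact whenever \<open>symmetric_valley p i\<close> holds.\<close>

definition valley_depth :: "nat list \<Rightarrow> nat \<Rightarrow> nat" where
  "valley_depth p i = p ! i - p ! (i + 1)"

definition dsv :: "nat \<Rightarrow> nat \<Rightarrow> nat" where
  "dsv n k = (\<Sum>(p, i) \<in> (SIGMA p:compositions n k. {i. symmetric_valley p i}). valley_depth p i)"

lemma finite_symmetric_valleys:
  "finite (SIGMA p:compositions n k. {i. symmetric_valley p i})"
proof (rule finite_SigmaI[OF finite_compositions])
  fix p
  show "finite {i. symmetric_valley p i}"
    by (rule finite_subset[of _ "{..<length p}"]) (auto simp: symmetric_valley_def)
qed

end

theory Submission
  imports Defs
begin

text \<open>
  Cutting the three parts \<open>b, m, b\<close> of a symmetric valley out of a composition of \<open>n\<close> with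
  \<open>k\<close> parts leaves a composition of \<open>n - 2b - m\<close> with \<open>k - 3\<close> parts, and for any fixed position the
  triple can be glued back in. So each of the \<open>k - 2\<close> possible positions contributes the same
  amount to \<open>dsv n k\<close>, namely the sum over all pairs \<open>1 \<le> m < b\<close> of \<open>b - m\<close> times the number of
  compositions of \<open>n - 2b - m\<close> with \<open>k - 3\<close> parts; this is \<open>dsv_eq_sum_valley_shapes\<close>.

  For \<open>k > 3\<close> that number is \<open>(n - 2b - m - 1 choose k - 4)\<close>. The bounds on \<open>m\<close> and \<open>b\<close> in the
  double sum say exactly that \<open>1 \<le> m < b\<close> and that at least one unit is left for each of the
  \<open>k - 3\<close> remaining parts; for all other pairs the number is \<open>0\<close>.
  For \<open>k = 3\<close> nothing is left over, so \<open>2b + m = n\<close>: then \<open>m\<close> determines \<open>b = (n - m) / 2\<close>, which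
  makes sense iff \<open>n - m\<close> is even, and the depth is \<open>b - m = (n - 3m) / 2\<close>.
\<close>

section \<open>Counting compositions\<close>

text \<open>
  Lowering every part by one turns a composition of \<open>n\<close> into a list of \<open>k\<close> natural numbers with
  sum \<open>n - k\<close>, which stars and bars counts.
\<close>

lemma card_compositions:
  assumes "0 < n" "0 < k"
  shows "card (compositions n k) = (n - 1) choose (k - 1)"
proof (cases "k \<le> n")
  case True
  have sum_Suc: "sum_list (map Suc l) = sum_list l + length l" for l
    by (induction l) auto
  have "bij_betw (map Suc) {l. length l = k \<and> sum_list l = n - k} (compositions n k)"
  proof (rule bij_betw_byWitness[where f' = "map (\<lambda>x. x - 1)"])
    show "\<forall>l\<in>{l. length l = k \<and> sum_list l = n - k}. map (\<lambda>x. x - 1) (map Suc l) = l"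
      by (simp add: comp_def)
    have inv: "map Suc (map (\<lambda>x. x - 1) p) = p" if "p \<in> compositions n k" for p
      using that by (auto simp: compositions_def intro!: map_idI)
    then show "\<forall>p\<in>compositions n k. map Suc (map (\<lambda>x. x - 1) p) = p"
      by blast
    show "map Suc ` {l. length l = k \<and> sum_list l = n - k} \<subseteq> compositions n k"
      using True by (auto simp: compositions_def sum_Suc)
    have "sum_list (map (\<lambda>x. x - 1) p) = n - k" if "p \<in> compositions n k" for p
      using sum_Suc[of "map (\<lambda>x. x - 1) p"] inv[OF that] that
      unfolding compositions_def by simp
    then show "map (\<lambda>x. x - 1) ` compositions n k \<subseteq> {l. length l = k \<and> sum_list l = n - k}"
      by (auto simp: compositions_def)
  qed
  then have "card (compositions n k) = card {l::nat list. length l = k \<and> sum_list l = n - k}"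
    by (metis bij_betw_same_card)
  also have "\<dots> = (n - 1) choose (n - k)"
    using True card_length_sum_list[of k "n - k"] by simp
  also have "\<dots> = (n - 1) choose (k - 1)"
    using True assms binomial_symmetric[of "k - 1" "n - 1"] by simp
  finally show ?thesis .
next
  case False
  have "length p \<le> sum_list p" if "\<forall>x\<in>set p. 0 < x" for p :: "nat list"
    using that by (induction p) auto
  then have "compositions n k = {}"
    using False unfolding compositions_def by blast
  then show ?thesis
    using False assms by (simp add: binomial_eq_0)
qed

section \<open>Cutting out a valley\<close>

text \<open>
  The bottom \<open>m\<close> comes first, then the height \<open>b\<close> of the two walls, in the order of the double sum.
  The bound by \<open>n\<close> keeps \<open>n - (2 * b + m)\<close> from being truncated: for \<open>k = 3\<close> a triple that is too
  large would otherwise be completed by the empty composition of \<open>0\<close>.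
\<close>

definition valley_shapes :: "nat \<Rightarrow> (nat \<times> nat) set" where
  "valley_shapes n = {(m, b). 0 < m \<and> m < b \<and> 2 * b + m \<le> n}"

lemma finite_valley_shapes: "finite (valley_shapes n)"
  by (rule finite_subset[of _ "{..n} \<times> {..n}"]) (auto simp: valley_shapes_def)

lemma split_at_triple:
  assumes "i + 2 < length p"
  shows "p = take i p @ [p ! i, p ! (i + 1), p ! (i + 2)] @ drop (i + 3) p"
proof -
  have "drop i p = p ! i # p ! (i + 1) # p ! (i + 2) # drop (i + 3) p"
    using assms by (simp add: Cons_nth_drop_Suc numeral_3_eq_3)
  then show ?thesis
    by (metis append_Cons append_Nil append_take_drop_id)
qed

text \<open>
  The contribution of one position \<open>i\<close>, through the bijection that cuts the triple out at \<open>i\<close>. The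
  right-hand side does not mention \<open>i\<close>, which is where the factor \<open>k - 2\<close> comes from.
\<close>

lemma sum_valley_depth_at_position:
  assumes "i + 2 < k"
  shows "(\<Sum>p | p \<in> compositions n k \<and> symmetric_valley p i. valley_depth p i) =
    (\<Sum>(m, b) \<in> valley_shapes n. card (compositions (n - (2 * b + m)) (k - 3)) * (b - m))"
proof -
  let ?T = "SIGMA (m, b) : valley_shapes n. compositions (n - (2 * b + m)) (k - 3)"
  let ?cut = "\<lambda>p :: nat list. ((p ! (i + 1), p ! i), take i p @ drop (i + 3) p)"
  let ?glue = "\<lambda>((m, b), q). take i q @ [b, m, b] @ drop i q"
  have "(\<Sum>p | p \<in> compositions n k \<and> symmetric_valley p i. valley_depth p i) =
    (\<Sum>((m, b), q) \<in> ?T. b - m)"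
  proof (rule sum.reindex_bij_witness[where i = ?glue and j = ?cut])
    fix p assume "p \<in> {p. p \<in> compositions n k \<and> symmetric_valley p i}"
    then have p: "length p = k" "\<forall>x\<in>set p. 0 < x" "sum_list p = n"
      "p ! (i + 1) < p ! i" "p ! (i + 2) = p ! i"
      by (auto simp: compositions_def symmetric_valley_def)
    note split = split_at_triple[of i p, unfolded p(5)]
    have eq: "take i p @ [p ! i, p ! (i + 1), p ! i] @ drop (i + 3) p = p"
      using split p(1) assms by simp
    show "?glue (?cut p) = p"
      using eq p(1) assms by simp
    have "sum_list (take i p @ [p ! i, p ! (i + 1), p ! i] @ drop (i + 3) p) = n"
      using eq p(3) by simp
    then have n: "n = 2 * p ! i + p ! (i + 1) + sum_list (take i p @ drop (i + 3) p)"
      by simp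
    have pos: "0 < p ! (i + 1)"
      using p(1,2) assms by simp
    have "\<forall>x\<in>set (take i p @ drop (i + 3) p). 0 < x"
      using p(2) by (auto dest: in_set_takeD in_set_dropD)
    moreover have "length (take i p @ drop (i + 3) p) = k - 3"
      using p(1) assms by simp
    ultimately show "?cut p \<in> ?T"
      using n pos p(4) by (simp add: valley_shapes_def compositions_def)
    show "(\<lambda>((m, b), q). b - m) (?cut p) = valley_depth p i"
      by (simp add: valley_depth_def)
  next
    fix t assume "t \<in> ?T"
    then obtain m b q where t: "t = ((m, b), q)" and mb: "0 < m" "m < b" "2 * b + m \<le> n"
      and q: "length q = k - 3" "\<forall>x\<in>set q. 0 < x" "sum_list q = n - (2 * b + m)"
      by (auto simp: valley_shapes_def compositions_def)
    have i: "i \<le> length q"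
      using q(1) assms by simp
    have nth: "?glue t ! i = b" "?glue t ! (i + 1) = m" "?glue t ! (i + 2) = b"
      using i by (auto simp: t nth_append)
    show "?cut (?glue t) = t"
      using i nth by (simp add: t)
    have "sum_list (take i q) + sum_list (drop i q) = sum_list q"
      by (metis append_take_drop_id sum_list_append)
    then have "sum_list (?glue t) = n"
      using q(3) mb by (simp add: t)
    moreover have "\<forall>x\<in>set (?glue t). 0 < x"
      using q(2) mb by (auto simp: t dest: in_set_takeD in_set_dropD)
    moreover have len: "length (?glue t) = k"
      using q(1) i assms by (simp add: t)
    ultimately have "?glue t \<in> compositions n k"
      by (simp add: compositions_def)
    moreover have "symmetric_valley (?glue t) i"
      unfolding symmetric_valley_def nth len using assms mb by simp
    ultimately show "?glue t \<in> {p. p \<in> compositions n k \<and> symmetric_valley p i}"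
      by blast
  qed
  also have "\<dots> = (\<Sum>x \<in> valley_shapes n.
      \<Sum>q \<in> (case x of (m, b) \<Rightarrow> compositions (n - (2 * b + m)) (k - 3)). case x of (m, b) \<Rightarrow> b - m)"
    by (subst sum.Sigma)
      (auto simp: finite_valley_shapes finite_compositions case_prod_unfold)
  also have "\<dots> = (\<Sum>(m, b) \<in> valley_shapes n. card (compositions (n - (2 * b + m)) (k - 3)) * (b - m))"
    by (rule sum.cong) auto
  finally show ?thesis .
qed

text \<open>
  Exchanging the order of summation: first over the \<open>k - 2\<close> positions, then over the compositions
  that have a symmetric valley there.
\<close>

lemma dsv_eq_sum_valley_shapes:
  "dsv n k = (k - 2) *
    (\<Sum>(m, b) \<in> valley_shapes n. card (compositions (n - (2 * b + m)) (k - 3)) * (b - m))"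
proof -
  have "dsv n k = (\<Sum>(i, p) \<in> (SIGMA i:{..<k - 2}. {p. p \<in> compositions n k \<and> symmetric_valley p i}).
      valley_depth p i)"
    unfolding dsv_def
    by (rule sum.reindex_bij_witness[where i = prod.swap and j = prod.swap])
      (auto simp: compositions_def symmetric_valley_def)
  also have "\<dots> = (\<Sum>i<k - 2. \<Sum>p | p \<in> compositions n k \<and> symmetric_valley p i. valley_depth p i)"
    by (rule sum.Sigma[symmetric]) (auto simp: finite_compositions)
  also have "\<dots> = (\<Sum>i<k - 2.
      \<Sum>(m, b) \<in> valley_shapes n. card (compositions (n - (2 * b + m)) (k - 3)) * (b - m))"
    by (rule sum.cong[OF refl], rule sum_valley_depth_at_position) auto
  finally show ?thesis
    by simp
qed

section \<open>The explicit ranges of summation\<close>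

theorem theorem8:
  shows "(\<forall>n k :: nat. k > 3 \<longrightarrow>
            int (dsv n k) =
              (int k - 2) *
              (\<Sum>m::int = 1..\<lfloor>(real n - real k + 1) / 3\<rfloor>.
                \<Sum>b::int = m + 1..\<lfloor>(real n - real_of_int m - (real k - 3)) / 2\<rfloor>.
                  int (nat (int n - 2 * b - m - 1) choose (k - 4)) * (b - m)))
       \<and> (\<forall>n :: nat.
            real (dsv n 3) =
              (\<Sum>m::int = 1..\<lfloor>(real n - 2) / 3\<rfloor>.
                if (real n - real_of_int m) / 2 \<in> \<int>
                then (real n - 3 * real_of_int m) / 2 else 0))"
proof (intro conjI allI impI)
  fix n k :: nat
  assume k: "k > 3"
  let ?R = "\<lambda>(m, b). int (nat (int n - 2 * b - m - 1) choose (k - 4)) * (b - m)"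
  let ?M = "{1..\<lfloor>(real n - real k + 1) / 3\<rfloor>}"
  let ?B = "\<lambda>m. {m + 1..\<lfloor>(real n - real_of_int m - (real k - 3)) / 2\<rfloor>}"
  let ?Q = "{(m, b) \<in> valley_shapes n. 2 * b + m + k \<le> n + 3}"
  \<comment> \<open>The guard matters when \<open>2b + m \<ge> n\<close> and \<open>k = 4\<close>: there are no compositions, but the binomial
    coefficient with truncated subtraction is \<open>0 choose 0 = 1\<close>.\<close>
  have card: "card (compositions (n - (2 * b + m)) (k - 3)) =
      (if 2 * b + m + k \<le> n + 3 then (n - (2 * b + m) - 1) choose (k - 4) else 0)" for m b
  proof (cases "n - (2 * b + m) = 0")
    case True
    then have "compositions (n - (2 * b + m)) (k - 3) = {}"
      using k by (cases "k - 3") (auto simp: compositions_def length_Suc_conv)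
    then show ?thesis
      using True k by simp
  next
    case False
    then show ?thesis
      using k card_compositions[of "n - (2 * b + m)" "k - 3"]
      by (auto simp: binomial_eq_0)
  qed
  have floor3: "m \<le> \<lfloor>(real n - real k + 1) / 3\<rfloor> \<longleftrightarrow> 3 * m + int k \<le> int n + 1" for m
  proof -
    have "m \<le> \<lfloor>(real n - real k + 1) / 3\<rfloor> \<longleftrightarrow>
        real_of_int (3 * m + int k) \<le> real_of_int (int n + 1)"
      by (simp add: le_floor_iff field_simps)
    then show ?thesis by (simp only: of_int_le_iff)
  qed
  have floor2: "b \<le> \<lfloor>(real n - real_of_int m - (real k - 3)) / 2\<rfloor> \<longleftrightarrow> 2 * b + m + int k \<le> int n + 3"
    for m b
  proof -
    have "b \<le> \<lfloor>(real n - real_of_int m - (real k - 3)) / 2\<rfloor> \<longleftrightarrow>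
        real_of_int (2 * b + m + int k) \<le> real_of_int (int n + 3)"
      by (simp add: le_floor_iff field_simps)
    then show ?thesis by (simp only: of_int_le_iff)
  qed
  have ranges: "Sigma ?M ?B = {(m, b). 1 \<le> m \<and> m < b \<and> 2 * b + m + int k \<le> int n + 3}"
    by (auto simp: floor3 floor2)
  have "int (dsv n k) = (int k - 2) * (\<Sum>(m, b) \<in> valley_shapes n.
      int (card (compositions (n - (2 * b + m)) (k - 3)) * (b - m)))"
    unfolding dsv_eq_sum_valley_shapes[of n k] using k
    by (simp add: of_nat_diff case_prod_unfold)
  also have "(\<Sum>(m, b) \<in> valley_shapes n.
      int (card (compositions (n - (2 * b + m)) (k - 3)) * (b - m))) =
      (\<Sum>(m, b) \<in> ?Q. int (card (compositions (n - (2 * b + m)) (k - 3)) * (b - m)))"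
    by (rule sum.mono_neutral_right) (auto simp: finite_valley_shapes card split: if_splits)
  also have "\<dots> = (\<Sum>x \<in> Sigma ?M ?B. ?R x)"
    unfolding ranges
  proof (rule sum.reindex_bij_witness
      [where i = "map_prod nat nat" and j = "map_prod int int"])
    fix x assume x: "x \<in> ?Q"
    obtain m b where mb: "x = (m, b)" by fastforce
    have "nat (int n - 2 * int b - int m - 1) = n - (2 * b + m) - 1"
      by linarith
    then show "?R (map_prod int int x) =
        (case x of (m, b) \<Rightarrow> int (card (compositions (n - (2 * b + m)) (k - 3)) * (b - m)))"
      using x by (simp add: mb valley_shapes_def card of_nat_diff)
  qed (use k in \<open>auto simp: valley_shapes_def\<close>)
  also have "\<dots> = (\<Sum>m \<in> ?M. \<Sum>b \<in> ?B m. ?R (m, b))"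
    by (subst sum.Sigma) auto
  finally show "int (dsv n k) = (int k - 2) *
      (\<Sum>m::int = 1..\<lfloor>(real n - real k + 1) / 3\<rfloor>.
        \<Sum>b::int = m + 1..\<lfloor>(real n - real_of_int m - (real k - 3)) / 2\<rfloor>.
          int (nat (int n - 2 * b - m - 1) choose (k - 4)) * (b - m))"
    by simp
next
  fix n :: nat
  let ?M = "{1..\<lfloor>(real n - 2) / 3\<rfloor>}"
  let ?Q = "{(m, b) \<in> valley_shapes n. 2 * b + m = n}"
  have card: "card (compositions (n - (2 * b + m)) 0) = (if n \<le> 2 * b + m then 1 else 0)" for m b
  proof -
    have "compositions (n - (2 * b + m)) 0 = (if n \<le> 2 * b + m then {[]} else {})"
      by (auto simp: compositions_def)
    then show ?thesis by simp
  qed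
  have floor3: "m \<le> \<lfloor>(real n - 2) / 3\<rfloor> \<longleftrightarrow> 3 * m + 2 \<le> int n" for m
  proof -
    have "m \<le> \<lfloor>(real n - 2) / 3\<rfloor> \<longleftrightarrow> real_of_int (3 * m + 2) \<le> real_of_int (int n)"
      by (simp add: le_floor_iff field_simps)
    then show ?thesis by (simp only: of_int_le_iff)
  qed
  have half: "(real n - real_of_int m) / 2 \<in> \<int> \<longleftrightarrow> even (int n - m)" for m
  proof -
    have "(real n - real_of_int m) / 2 = real_of_int c \<longleftrightarrow> int n - m = 2 * c" for c
    proof -
      have "(real n - real_of_int m) / 2 = real_of_int c \<longleftrightarrow>
          real_of_int (int n - m) = real_of_int (2 * c)"
        by (simp add: field_simps)
      then show ?thesis by (simp only: of_int_eq_iff)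
    qed
    then show ?thesis
      by (auto simp: Ints_def image_iff dvd_def)
  qed
  have "real (dsv n 3) = (\<Sum>(m, b) \<in> valley_shapes n.
      real (card (compositions (n - (2 * b + m)) 0) * (b - m)))"
    unfolding dsv_eq_sum_valley_shapes[of n 3] by (simp add: case_prod_unfold)
  also have "\<dots> = (\<Sum>(m, b) \<in> ?Q. real (card (compositions (n - (2 * b + m)) 0) * (b - m)))"
    by (rule sum.mono_neutral_right)
      (use finite_valley_shapes[of n] in \<open>auto simp: card valley_shapes_def split: if_splits\<close>)
  also have "\<dots> = (\<Sum>m | m \<in> ?M \<and> even (int n - m). (real n - 3 * real_of_int m) / 2)"
  proof (rule sum.reindex_bij_witness
      [where i = "\<lambda>m. (nat m, nat ((int n - m) div 2))" and j = "\<lambda>(m, b). int m"])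
    fix m assume "m \<in> {m. m \<in> ?M \<and> even (int n - m)}"
    then have m: "1 \<le> m" "3 * m + 2 \<le> int n" "even (int n - m)"
      by (auto simp: floor3)
    then obtain c where c: "int n - m = 2 * c" by (elim evenE)
    then show "(nat m, nat ((int n - m) div 2)) \<in> ?Q"
      using m by (auto simp: valley_shapes_def)
    show "(case (nat m, nat ((int n - m) div 2)) of (m, b) \<Rightarrow> int m) = m"
      using m by simp
  qed (auto simp: valley_shapes_def floor3 card of_nat_diff)
  also have "\<dots> = (\<Sum>m \<in> ?M. if even (int n - m) then (real n - 3 * real_of_int m) / 2 else 0)"
    by (rule sum.mono_neutral_cong_left) auto
  finally show "real (dsv n 3) = (\<Sum>m::int = 1..\<lfloor>(real n - 2) / 3\<rfloor>.
      if (real n - real_of_int m) / 2 \<in> \<int> then (real n - 3 * real_of_int m) / 2 else 0)"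
    unfolding half .
qed

end
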